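(* Let $R$ be a commutative ring and $d\le n$. There is an algebraic branching program over $R$ that computes along the way every polynomial in $\{\mathrm{cpc}_{n',d'} : n'\le n,\ d'\le d\}$ and has width at most $\frac{n^2}{2}$ plus lower-order terms; in particular $\mathrm{w}(\{\mathrm{cpc}_{n',d'}\mid n'\le n,\ d'\le d\})\le \frac{n^2}{2}+\text{lower-order terms}$. The total number of vertices of this algebraic branching program is $\frac{dn^2}{2}-\frac{d^3}{6}$ plus lower-order terms, which for $d=n$ is $\frac{n^3}{3}$ plus lower-order terms.
   Context: $X_m=(x_{i,j})_{1\le i,j\le m}$ denotes the $m\times m$ matrix of indeterminates; $\mathrm{cpc}_{m,k}$ is defined by $\det(X_m+tI_m)=\sum_{k\ge0}\mathrm{cpc}_{m,m-k}t^k$, i.e. it is the sum of the $k\times k$ principal minors of $X_m$, a homogeneous polynomial of degree $k$. An algebraic branching program (ABP) is a directed acyclic graph whose vertices each lie in a layer $0,1,\dots,D$; each edge either joins two vertices of the same layer and is labeled by a constant in $R$ (constant edges), or goes from a vertex in layer $i$ to a vertex in layer $i+1$ and is labeled by a homogeneous linear polynomial over $R$. There is a distinguished source vertex $s$ in layer $0$. The ABP computes a polynomial $f$ at a vertex $v$ (computes $f$ along the way) if $f$ equals the sum, over all directed paths from $s$ to $v$, of the product of the edge labels along the path. The width of an ABP is the maximum number of vertices in any of the layers $1,\dots,D-1$. For a finite set $S$ of polynomials, $\mathrm{w}(S)$ is the smallest width of an ABP that computes every element of $S$ along the way (several sinks in the last layer are allowed). *)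

theory Defs
  imports
    "HOL-Library.Poly_Mapping"
    "HOL-Library.Landau_Symbols"
    "HOL-Computational_Algebra.Polynomial"
    "Jordan_Normal_Form.Determinant"
begin

text \<open>
  Polynomials over \<open>'a\<close> in the variables \<open>x (i, j)\<close>, with \<open>i\<close> and \<open>j\<close> counted from 0:
  finitely supported maps from monomials (finitely supported exponent maps) to coefficients.
\<close>

type_synonym 'a mpol = "((nat \<times> nat) \<Rightarrow>\<^sub>0 nat) \<Rightarrow>\<^sub>0 'a"

definition const_pol :: "'a::comm_ring_1 \<Rightarrow> 'a mpol" where
  "const_pol c = Poly_Mapping.single 0 c"

definition var_pol :: "nat \<times> nat \<Rightarrow> 'a::comm_ring_1 mpol" where
  "var_pol v = Poly_Mapping.single (Poly_Mapping.single v 1) 1"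

definition homogeneous_linear :: "'a::comm_ring_1 mpol \<Rightarrow> bool" where
  "homogeneous_linear p \<longleftrightarrow> (\<forall>m \<in> Poly_Mapping.keys p. \<exists>v. m = Poly_Mapping.single v 1)"

definition generic_mat :: "nat \<Rightarrow> 'a::comm_ring_1 mpol mat" where
  "generic_mat m = mat m m var_pol"

text \<open>
  The coefficient of \<open>t ^ (m - k)\<close> in \<open>det (X\<^sub>m + t I\<^sub>m)\<close>. For \<open>k > m\<close> there are no
  \<open>k \<times> k\<close> principal minors and the value is 0; the case distinction is needed because
  subtraction on the natural numbers truncates.
\<close>

definition cpc :: "nat \<Rightarrow> nat \<Rightarrow> 'a::comm_ring_1 mpol" where
  "cpc m k =
     (if k \<le> m
      then coeff (det (map_mat (\<lambda>a. [:a:]) (generic_mat m) + [:0, 1:] \<cdot>\<^sub>m 1\<^sub>m m)) (m - k)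
      else 0)"

record (overloaded) ('v, 'a::zero) abp =
  verts :: "'v set"
  arcs :: "('v \<times> 'v) set"
  lab :: "'v \<times> 'v \<Rightarrow> 'a mpol"
  layer :: "'v \<Rightarrow> nat"
  depth :: nat
  source :: 'v

definition is_abp :: "('v, 'a::comm_ring_1) abp \<Rightarrow> bool" where
  "is_abp A \<longleftrightarrow>
     finite (verts A) \<and> arcs A \<subseteq> verts A \<times> verts A \<and> acyclic (arcs A) \<and>
     (\<forall>v \<in> verts A. layer A v \<le> depth A) \<and>
     source A \<in> verts A \<and> layer A (source A) = 0 \<and>
     (\<forall>(u, v) \<in> arcs A.
        (layer A v = layer A u \<and> (\<exists>c. lab A (u, v) = const_pol c)) \<or>
        (layer A v = Suc (layer A u) \<and> homogeneous_linear (lab A (u, v))))"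

text \<open>
  A path is its nonempty list of vertices; the list \<open>[u]\<close> is the path of length 0 from \<open>u\<close>
  to \<open>u\<close>, whose weight is 1. For an ABP the set of all paths is finite, so that the sum in
  \<open>value_at\<close> is a genuine one.
\<close>

definition paths :: "('v, 'a::comm_ring_1) abp \<Rightarrow> 'v \<Rightarrow> 'v \<Rightarrow> 'v list set" where
  "paths A u v =
     {p. p \<noteq> [] \<and> set p \<subseteq> verts A \<and> hd p = u \<and> last p = v \<and>
         successively (\<lambda>x y. (x, y) \<in> arcs A) p}"

definition path_weight :: "('v, 'a::comm_ring_1) abp \<Rightarrow> 'v list \<Rightarrow> 'a mpol" where
  "path_weight A p = prod_list (map (lab A) (zip p (tl p)))"

definition value_at :: "('v, 'a::comm_ring_1) abp \<Rightarrow> 'v \<Rightarrow> 'a mpol" where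
  "value_at A v = (\<Sum>p \<in> paths A (source A) v. path_weight A p)"

definition computes :: "('v, 'a::comm_ring_1) abp \<Rightarrow> 'a mpol \<Rightarrow> bool" where
  "computes A f \<longleftrightarrow> (\<exists>v \<in> verts A. value_at A v = f)"

text \<open>
  Only the layers strictly between the first and the last one count; the width is 0 if
  there are none.
\<close>

definition abp_width :: "('v, 'a::comm_ring_1) abp \<Rightarrow> nat" where
  "abp_width A =
     Max (insert 0 ((\<lambda>i. card {v \<in> verts A. layer A v = i}) ` {0<..<depth A}))"

text \<open>
  Vertices may be taken to be natural numbers, since every ABP is finite and hence isomorphic
  to one of this kind.
\<close>

definition min_width :: "'a::comm_ring_1 mpol set \<Rightarrow> nat" where
  "min_width S =
     (LEAST k. \<exists>A :: (nat, 'a) abp. is_abp A \<and> (\<forall>f \<in> S. computes A f) \<and> abp_width A = k)"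

text \<open>
  The filter of pairs \<open>(n, d)\<close> with \<open>d \<le> n\<close> and \<open>n \<rightarrow> \<infinity>\<close>, uniformly in \<open>d\<close>.
\<close>

definition at_top_le :: "(nat \<times> nat) filter" where
  "at_top_le = inf (filtercomap fst at_top) (principal {(n, d). d \<le> n})"

end

theory Submission
  imports Defs "Jordan_Normal_Form.Char_Poly" "HOL-Real_Asymp.Real_Asymp"
begin

text \<open>
  Let \<open>S\<^sub>m = X\<^sub>m + t I\<close> and let \<open>r\<close> and \<open>q\<close> be the last row and column of \<open>X\<^sub>m\<^sub>+\<^sub>1\<close> without the
  corner entry. Expanding the bordered determinant gives
  \<open>det S\<^sub>m\<^sub>+\<^sub>1 = (x\<^sub>m\<^sub>m + t) det S\<^sub>m - r adj(S\<^sub>m) q\<close>, and \<open>adj(S\<^sub>m) S\<^sub>m = det S\<^sub>m I\<close> expresses each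
  \<open>t\<close>-coefficient of the row vector \<open>r adj(S\<^sub>m)\<close> through the next higher one and a coefficient of
  \<open>det S\<^sub>m\<close>. Read degree by degree, these two recurrences are the transition rules of a branching
  program whose states in layer \<open>k\<close> are the \<open>cpc m k\<close> and the entries of the coefficient of
  \<open>t ^ (m - k)\<close> in \<open>r adj(S\<^sub>m)\<close> for \<open>k \<le> m < n\<close>.
\<close>

section \<open>Determinants: a degree bound and the bordered expansion\<close>

lemma degree_det_le:
  fixes A :: "'a::comm_ring_1 poly mat"
  assumes A: "A \<in> carrier_mat n n"
    and deg: "\<And>i j. i < n \<Longrightarrow> j < n \<Longrightarrow> degree (A $$ (i, j)) \<le> 1"
  shows "degree (det A) \<le> n"
  unfolding det_def'[OF A]
proof (rule degree_sum_le)
  fix p assume "p \<in> {p. p permutes {0..<n}}"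
  then have p: "p permutes {0..<n}" by simp
  have "degree (\<Prod>i = 0..<n. A $$ (i, p i)) \<le> (\<Sum>i = 0..<n. degree (A $$ (i, p i)))"
    using degree_prod_sum_le[of "{0..<n}" "\<lambda>i. A $$ (i, p i)"] by (simp add: o_def)
  also have "\<dots> \<le> (\<Sum>i = 0..<n. 1)"
    using p by (intro sum_mono deg) (auto dest: permutes_in_image)
  finally show "degree (signof p * (\<Prod>i = 0..<n. A $$ (i, p i))) \<le> n"
    by simp
qed (simp add: finite_permutations)

text \<open>This is the division-free form of the Schur complement formula. Expand along the last
  column; every minor except the corner one still contains the last row of \<open>M\<close>, and
  expanding it along that row leaves the cofactors of \<open>B\<close>.\<close>

lemma det_bordered:
  fixes M :: "'a::comm_ring_1 mat"
  assumes M: "M \<in> carrier_mat (Suc m) (Suc m)" and B: "B \<in> carrier_mat m m"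
    and MB: "\<And>i j. i < m \<Longrightarrow> j < m \<Longrightarrow> M $$ (i, j) = B $$ (i, j)"
  shows "det M = M $$ (m, m) * det B
    - (\<Sum>c<m. (\<Sum>j<m. M $$ (m, j) * adj_mat B $$ (j, c)) * M $$ (c, m))"
proof -
  have corner: "cofactor M m m = det B"
  proof -
    have "mat_delete M m m = B"
      using M B MB by (intro eq_matI) (auto simp: mat_delete_def)
    then show ?thesis by (simp add: cofactor_def flip: mult_2)
  qed
  have side: "cofactor M c m = - (\<Sum>j<m. M $$ (m, j) * adj_mat B $$ (j, c))" if c: "c < m" for c
  proof -
    define N where "N = mat_delete M c m"
    have N: "N \<in> carrier_mat m m"
      using mat_delete_carrier[OF M] by (simp add: N_def)
    \<comment> \<open>Since row \<open>c < m\<close> is deleted, row \<open>m\<close> of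
      \<open>M\<close> has moved up to index \<open>m - 1\<close> in \<open>N\<close>.\<close>
    have "det N = (\<Sum>j<m. N $$ (m - 1, j) * cofactor N (m - 1) j)"
      by (rule laplace_expansion_row[OF N]) (use c in simp)
    also have "\<dots> = (\<Sum>j<m. M $$ (m, j) * ((-1) ^ (m - 1 + j) * det (mat_delete B c j)))"
    proof (rule sum.cong[OF refl])
      fix j assume "j \<in> {..<m}"
      then have j: "j < m" by simp
      have "N $$ (m - 1, j) = M $$ (m, j)"
        using M c j by (auto simp: N_def mat_delete_def)
      moreover have "mat_delete N (m - 1) j = mat_delete B c j"
        using M B c j by (intro eq_matI) (auto simp: N_def mat_delete_def MB)
      ultimately show "N $$ (m - 1, j) * cofactor N (m - 1) j
          = M $$ (m, j) * ((-1) ^ (m - 1 + j) * det (mat_delete B c j))"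
        by (simp add: cofactor_def)
    qed
    finally have detN:
      "det N = (\<Sum>j<m. M $$ (m, j) * ((-1) ^ (m - 1 + j) * det (mat_delete B c j)))" .
    \<comment> \<open>The exponents add up to \<open>c + j\<close> plus the odd number
      \<open>2 * m - 1\<close>; this is the source of the minus sign in front of the sum.\<close>
    have sign: "(-1 :: 'a) ^ (c + m) * (-1) ^ (m - 1 + j) = - ((-1) ^ (c + j))" for j
    proof -
      obtain l where "m = Suc l" using c by (cases m) auto
      then show ?thesis by (simp add: power_add algebra_simps flip: power_mult_distrib)
    qed
    have "cofactor M c m
        = (\<Sum>j<m. M $$ (m, j) * (((-1) ^ (c + m) * (-1) ^ (m - 1 + j)) * det (mat_delete B c j)))"
      unfolding cofactor_def N_def[symmetric] detN by (simp add: sum_distrib_left ac_simps)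
    also have "\<dots> = - (\<Sum>j<m. M $$ (m, j) * adj_mat B $$ (j, c))"
      unfolding sign sum_negf[symmetric]
      using B c by (intro sum.cong) (auto simp: adj_mat_def cofactor_def)
    finally show ?thesis .
  qed
  have "det M = (\<Sum>c<Suc m. M $$ (c, m) * cofactor M c m)"
    by (rule laplace_expansion_column[OF M]) simp
  also have "\<dots> = (\<Sum>c<m. M $$ (c, m) * cofactor M c m) + M $$ (m, m) * det B"
    by (simp add: corner)
  also have "(\<Sum>c<m. M $$ (c, m) * cofactor M c m)
      = - (\<Sum>c<m. (\<Sum>j<m. M $$ (m, j) * adj_mat B $$ (j, c)) * M $$ (c, m))"
    unfolding sum_negf[symmetric] by (intro sum.cong) (auto simp: side)
  finally show ?thesis by simp
qed

section \<open>Recurrences for the coefficients of \<open>det S\<^sub>m\<close> and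
  \<open>r adj(S\<^sub>m)\<close>\<close>

definition shifted_generic_mat :: "nat \<Rightarrow> 'a::comm_ring_1 mpol poly mat" where
  "shifted_generic_mat m = map_mat (\<lambda>a. [:a:]) (generic_mat m) + [:0, 1:] \<cdot>\<^sub>m 1\<^sub>m m"

lemma shifted_generic_mat_carrier [simp]: "shifted_generic_mat m \<in> carrier_mat m m"
  by (simp add: shifted_generic_mat_def generic_mat_def)

lemma dim_shifted_generic_mat [simp]:
  "dim_row (shifted_generic_mat m) = m" "dim_col (shifted_generic_mat m) = m"
  by (simp_all add: shifted_generic_mat_def generic_mat_def)

lemma shifted_generic_mat_index:
  "i < m \<Longrightarrow> j < m \<Longrightarrow>
    shifted_generic_mat m $$ (i, j) = [:var_pol (i, j), if i = j then 1 else 0:]"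
  by (simp add: shifted_generic_mat_def generic_mat_def)

lemma cpc_eq_coeff_det: "k \<le> m \<Longrightarrow> cpc m k = coeff (det (shifted_generic_mat m)) (m - k)"
  by (simp add: cpc_def shifted_generic_mat_def)

lemma cpc_eq_0: "m < k \<Longrightarrow> cpc m k = 0"
  by (simp add: cpc_def)

lemma cpc_0_left: "cpc 0 k = (if k = 0 then 1 else 0)"
  by (simp add: cpc_def generic_mat_def)

text \<open>For \<open>c < m\<close> this is entry \<open>c\<close> of the row vector
  \<open>r adj(S\<^sub>m)\<close>.\<close>

definition bordered_row :: "nat \<Rightarrow> nat \<Rightarrow> 'a::comm_ring_1 mpol poly" where
  "bordered_row m c =
     (\<Sum>j<m. [:var_pol (m, j):] * adj_mat (shifted_generic_mat m) $$ (j, c))"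

text \<open>
  Up to sign, the generating polynomial of pairs of a clow sequence on \<open>{0..<m}\<close> and a walk that
  starts in \<open>m\<close>, stays below \<open>m\<close> afterwards and ends in \<open>c\<close>, of \<open>k\<close> edges in total. It is only
  meaningful for \<open>k \<le> m\<close>, as the subtraction truncates.
\<close>

definition open_walk :: "nat \<Rightarrow> nat \<Rightarrow> nat \<Rightarrow> 'a::comm_ring_1 mpol" where
  "open_walk m c k = coeff (bordered_row m c) (m - k)"

text \<open>The entries of the adjugate are signed minors of size \<open>m - 1\<close>, hence of
  degree at most \<open>m - 1\<close> in \<open>t\<close>. The case \<open>l = m\<close> starts the
  recurrence for \<open>open_walk\<close>.\<close>

lemma coeff_bordered_row_eq_0:
  assumes c: "c < m" and l: "m \<le> l"
  shows "coeff (bordered_row m c :: 'a::comm_ring_1 mpol poly) l = 0"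
proof -
  let ?S = "shifted_generic_mat m :: 'a mpol poly mat"
  have adj: "coeff (adj_mat ?S $$ (j, c)) l = 0" if j: "j < m" for j
  proof (rule coeff_eq_0)
    have "degree (det (mat_delete ?S c j)) \<le> m - 1"
    proof (rule degree_det_le)
      show "mat_delete ?S c j \<in> carrier_mat (m - 1) (m - 1)"
        by (rule mat_delete_carrier) simp
      show "degree (mat_delete ?S c j $$ (i, i')) \<le> 1" if "i < m - 1" "i' < m - 1" for i i'
        using that c j
        by (auto simp: mat_delete_def shifted_generic_mat_index)
    qed
    moreover have "adj_mat ?S $$ (j, c) = (-1) ^ (c + j) * det (mat_delete ?S c j)"
      using c j
      by (auto simp: adj_mat_def cofactor_def)
    moreover have "degree ((-1) ^ (c + j) * p) = degree p" for p :: "'a mpol poly"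
      by (cases "even (c + j)") simp_all
    ultimately show "degree (adj_mat ?S $$ (j, c)) < l"
      using c l by simp
  qed
  then show ?thesis
    by (simp add: bordered_row_def coeff_sum)
qed

lemma open_walk_0: "c < m \<Longrightarrow> open_walk m c 0 = 0"
  by (simp add: open_walk_def coeff_bordered_row_eq_0)

text \<open>Entry \<open>c\<close> of the identity
  \<open>r adj(S\<^sub>m) S\<^sub>m = det S\<^sub>m r\<close>.\<close>

lemma bordered_row_mult_shifted:
  assumes c: "c < m"
  shows "(\<Sum>c'<m. bordered_row m c' * shifted_generic_mat m $$ (c', c))
    = [:var_pol (m, c):] * det (shifted_generic_mat m :: 'a::comm_ring_1 mpol poly mat)"
proof -
  let ?S = "shifted_generic_mat m :: 'a mpol poly mat"
  have S: "?S \<in> carrier_mat m m" by simp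
  have prod: "(\<Sum>c'<m. adj_mat ?S $$ (j, c') * ?S $$ (c', c)) = (if j = c then det ?S else 0)"
    if j: "j < m" for j
  proof -
    have "(\<Sum>c'<m. adj_mat ?S $$ (j, c') * ?S $$ (c', c)) = (adj_mat ?S * ?S) $$ (j, c)"
      using adj_mat(1)[OF S] j c
      by (auto simp: times_mat_def scalar_prod_def atLeast0LessThan intro!: sum.cong)
    also have "\<dots> = (if j = c then det ?S else 0)"
      using j c by (simp add: adj_mat(3)[OF S])
    finally show ?thesis .
  qed
  have "(\<Sum>c'<m. bordered_row m c' * ?S $$ (c', c))
      = (\<Sum>j<m. [:var_pol (m, j):] * (\<Sum>c'<m. adj_mat ?S $$ (j, c') * ?S $$ (c', c)))"
    unfolding bordered_row_def sum_distrib_right sum_distrib_left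
    by (subst sum.swap) (simp add: ac_simps)
  also have "\<dots> = (\<Sum>j<m. if j = c then [:var_pol (m, j):] * det ?S else 0)"
    by (intro sum.cong) (auto simp: prod)
  finally show ?thesis using c by simp
qed

text \<open>Compare the coefficients of \<open>t ^ (m - k)\<close> in
  \<open>bordered_row_mult_shifted\<close>. The \<open>t\<close> on the diagonal of
  \<open>S\<^sub>m\<close> brings in the coefficient one lower, which is
  \<open>open_walk m c (Suc k)\<close>; solve for it.\<close>

lemma open_walk_Suc:
  assumes c: "c < m" and k: "k < m"
  shows "(open_walk m c (Suc k) :: 'a::comm_ring_1 mpol)
    = var_pol (m, c) * cpc m k - (\<Sum>c'<m. open_walk m c' k * var_pol (c', c))"
proof -
  obtain l where l: "m - k = Suc l" "m - Suc k = l"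
    using k by (cases "m - k") auto
  have entry: "coeff (bordered_row m c' * shifted_generic_mat m $$ (c', c)) (Suc l)
      = open_walk m c' k * var_pol (c', c)
        + (if c' = c then coeff (bordered_row m c) l else 0)" if "c' < m" for c'
    using that c l(1) by (simp add: shifted_generic_mat_index open_walk_def mult.commute)
  have "(var_pol (m, c) * cpc m k :: 'a mpol)
      = coeff (\<Sum>c'<m. bordered_row m c' * shifted_generic_mat m $$ (c', c)) (Suc l)"
    using k by (simp add: bordered_row_mult_shifted[OF c] cpc_eq_coeff_det l)
  also have "\<dots> = (\<Sum>c'<m. open_walk m c' k * var_pol (c', c)) + coeff (bordered_row m c) l"
    using c by (simp add: coeff_sum entry sum.distrib)
  finally show ?thesis by (simp add: open_walk_def l)
qed

lemma det_shifted_generic_mat_Suc: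
  "det (shifted_generic_mat (Suc m)) = [:var_pol (m, m), 1:] * det (shifted_generic_mat m)
    - (\<Sum>c<m. bordered_row m c * [:var_pol (c, m):])"
  by (subst det_bordered[of _ m "shifted_generic_mat m"])
    (auto simp: shifted_generic_mat_index bordered_row_def intro!: sum.cong)

lemma coeff_det_shifted_generic_mat_eq_0:
  "m < l \<Longrightarrow> coeff (det (shifted_generic_mat m)) l = 0"
  by (rule coeff_eq_0, rule le_less_trans[OF degree_det_le])
    (auto simp: shifted_generic_mat_index)

text \<open>In the coefficient of \<open>t ^ (m + 1)\<close> only \<open>t * det S\<^sub>m\<close>
  survives, all other terms having degree at most \<open>m\<close>.\<close>

lemma cpc_Suc_0: "cpc (Suc m) 0 = cpc m 0"
  by (simp add: cpc_eq_coeff_det det_shifted_generic_mat_Suc coeff_sum coeff_bordered_row_eq_0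
      coeff_det_shifted_generic_mat_eq_0)

text \<open>Compare the coefficients of \<open>t ^ (m - k)\<close> in
  \<open>det_shifted_generic_mat_Suc\<close>. For \<open>k = m\<close> this is the constant term, to
  which \<open>t * det S\<^sub>m\<close> contributes nothing, in accordance with
  \<open>cpc m (Suc m) = 0\<close>.\<close>

lemma cpc_Suc_Suc:
  assumes "k \<le> m"
  shows "cpc (Suc m) (Suc k) = cpc m (Suc k) + cpc m k * var_pol (m, m)
    - (\<Sum>c<m. open_walk m c k * var_pol (c, m))"
proof (cases "k = m")
  case True
  then show ?thesis
    by (simp add: cpc_eq_coeff_det cpc_eq_0 det_shifted_generic_mat_Suc coeff_sum open_walk_def
        mult.commute)
next
  case False
  then obtain l where l: "m - k = Suc l" "m - Suc k = l"
    using assms by (cases "m - k") auto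
  then show ?thesis using assms False
    by (simp add: cpc_eq_coeff_det det_shifted_generic_mat_Suc coeff_sum open_walk_def mult.commute)
qed

section \<open>Paths and values in arbitrary branching programs\<close>

lemma paths_rec:
  assumes "arcs A \<subseteq> verts A \<times> verts A" and "v \<in> verts A"
  shows "paths A s v = (if v = s then {[s]} else {})
    \<union> (\<Union>u \<in> {u. (u, v) \<in> arcs A}. (\<lambda>p. p @ [v]) ` paths A s u)"
proof (intro equalityI subsetI)
  fix p assume p: "p \<in> paths A s v"
  then have "p \<noteq> []" by (simp add: paths_def)
  then obtain q w where pq: "p = q @ [w]" by (metis rev_exhaust)
  show "p \<in> (if v = s then {[s]} else {})
      \<union> (\<Union>u \<in> {u. (u, v) \<in> arcs A}. (\<lambda>p. p @ [v]) ` paths A s u)"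
    using p pq assms by (cases "q = []") (auto simp: paths_def successively_append_iff)
next
  fix p assume "p \<in> (if v = s then {[s]} else {})
      \<union> (\<Union>u \<in> {u. (u, v) \<in> arcs A}. (\<lambda>p. p @ [v]) ` paths A s u)"
  then show "p \<in> paths A s v"
    using assms by (auto simp: paths_def successively_append_iff split: if_splits)
qed

lemma path_weight_snoc:
  assumes "p \<noteq> []"
  shows "path_weight A (p @ [v]) = path_weight A p * lab A (last p, v)"
  using assms
proof (induction p rule: list_nonempty_induct)
  case (single x)
  then show ?case by (simp add: path_weight_def)
next
  case (cons x xs)
  then show ?case by (cases xs) (simp_all add: path_weight_def mult.assoc)
qed

lemma is_abpD:
  assumes "is_abp A"
  shows "finite (verts A)" "arcs A \<subseteq> verts A \<times> verts A" "wf (arcs A)"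
proof -
  show *: "finite (verts A)" "arcs A \<subseteq> verts A \<times> verts A"
    using assms by (auto simp: is_abp_def)
  then have "finite (arcs A)"
    by (meson finite_SigmaI finite_subset)
  then show "wf (arcs A)"
    using assms by (simp add: finite_acyclic_wf is_abp_def)
qed

lemma finite_in_arcs:
  assumes "is_abp A"
  shows "finite {u. (u, v) \<in> arcs A}"
  by (rule finite_subset[OF _ is_abpD(1)[OF assms]]) (use is_abpD(2)[OF assms] in auto)

lemma finite_paths:
  assumes A: "is_abp A" and v: "v \<in> verts A"
  shows "finite (paths A s v)"
  using is_abpD(3)[OF A] v
proof (induction v rule: wf_induct_rule)
  case (less v)
  have "finite (paths A s u)" if "(u, v) \<in> arcs A" for u
    using less.IH[OF that] that is_abpD(2)[OF A] by auto
  then show ?case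
    using finite_in_arcs[OF A] by (subst paths_rec[OF is_abpD(2)[OF A] less.prems]) auto
qed

text \<open>Split the paths to \<open>v\<close> by their last arc; the trivial path accounts for the
  extra 1 at the source.\<close>

lemma value_at_rec:
  assumes A: "is_abp A" and v: "v \<in> verts A"
  shows "value_at A v = (if v = source A then 1 else 0)
    + (\<Sum>u | (u, v) \<in> arcs A. value_at A u * lab A (u, v))"
proof -
  let ?s = "source A" and ?I = "{u. (u, v) \<in> arcs A}"
  let ?P = "\<lambda>u. (\<lambda>p. p @ [v]) ` paths A ?s u"
  have fin: "finite (?P u)" if "u \<in> ?I" for u
    using that is_abpD(2)[OF A] by (auto intro!: finite_paths[OF A])
  \<comment> \<open>The predecessor \<open>u\<close> can be read off as the last vertex of
    \<open>p\<close>.\<close>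
  have disj: "?P u \<inter> ?P u' = {}" if "u \<noteq> u'" for u u'
    using that by (auto simp: paths_def)
  have nempty: "[] \<notin> paths A ?s u" for u
    by (simp add: paths_def)
  have "value_at A v = (\<Sum>p \<in> (if v = ?s then {[?s]} else {}) \<union> (\<Union>u\<in>?I. ?P u). path_weight A p)"
    unfolding value_at_def by (subst paths_rec[OF is_abpD(2)[OF A] v]) simp
  also have "\<dots> = (\<Sum>p \<in> (if v = ?s then {[?s]} else {}). path_weight A p)
      + (\<Sum>p \<in> (\<Union>u\<in>?I. ?P u). path_weight A p)"
    using fin finite_in_arcs[OF A] nempty by (intro sum.union_disjoint) auto
  also have "(\<Sum>p \<in> (if v = ?s then {[?s]} else {}). path_weight A p) = (if v = ?s then 1 else 0)"
    by (simp add: path_weight_def)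
  also have "(\<Sum>p \<in> (\<Union>u\<in>?I. ?P u). path_weight A p) = (\<Sum>u\<in>?I. \<Sum>p\<in>?P u. path_weight A p)"
    using fin finite_in_arcs[OF A] disj by (intro sum.UNION_disjoint) auto
  also have "\<dots> = (\<Sum>u\<in>?I. value_at A u * lab A (u, v))"
  proof (rule sum.cong[OF refl])
    fix u
    have "(\<Sum>p\<in>?P u. path_weight A p) = (\<Sum>p\<in>paths A ?s u. path_weight A (p @ [v]))"
      by (subst sum.reindex) (auto simp: inj_on_def)
    also have "\<dots> = (\<Sum>p\<in>paths A ?s u. path_weight A p * lab A (u, v))"
      by (intro sum.cong) (auto simp: paths_def path_weight_snoc)
    finally show "(\<Sum>p\<in>?P u. path_weight A p) = value_at A u * lab A (u, v)"
      by (simp add: value_at_def sum_distrib_right)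
  qed
  finally show ?thesis .
qed

text \<open>Since the arcs are well-founded, the recurrence has only one solution. Correctness of a
  program thus reduces to a local check at each vertex.\<close>

lemma value_at_unique:
  assumes A: "is_abp A"
    and rec: "\<And>v. v \<in> verts A \<Longrightarrow> val v = (if v = source A then 1 else 0)
      + (\<Sum>u | (u, v) \<in> arcs A. val u * lab A (u, v))"
    and v: "v \<in> verts A"
  shows "value_at A v = val v"
  using is_abpD(3)[OF A] v
proof (induction v rule: wf_induct_rule)
  case (less v)
  have "value_at A u = val u" if "(u, v) \<in> arcs A" for u
    using less.IH[OF that] that is_abpD(2)[OF A] by auto
  then show ?case
    by (simp add: value_at_rec[OF A less.prems] rec[OF less.prems])
qed

text \<open>Transfers a program with any vertex type to the natural numbers, over which
  \<open>min_width\<close> ranges.\<close>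

lemma abp_relabel_nat:
  fixes A :: "('v, 'a::comm_ring_1) abp"
  assumes A: "is_abp A"
  obtains B :: "(nat, 'a) abp" where "is_abp B" "\<And>f. computes A f \<Longrightarrow> computes B f"
    "abp_width B = abp_width A" "card (verts B) = card (verts A)"
proof -
  obtain e :: "'v \<Rightarrow> nat" where e: "inj_on e (verts A)"
    using finite_imp_inj_to_nat_seg[OF is_abpD(1)[OF A]] by blast
  define g where "g = the_inv_into (verts A) e"
  have g: "g (e v) = v" if "v \<in> verts A" for v
    using that e by (simp add: g_def the_inv_into_f_f)
  define B :: "(nat, 'a) abp" where
    "B = \<lparr>verts = e ` verts A, arcs = map_prod e e ` arcs A, lab = lab A \<circ> map_prod g g,
          layer = layer A \<circ> g, depth = depth A, source = e (source A)\<rparr>"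
  have arc: "u \<in> verts A" "v \<in> verts A" if "(u, v) \<in> arcs A" for u v
    using that is_abpD(2)[OF A] by auto
  have src: "source A \<in> verts A"
    using A by (simp add: is_abp_def)
  \<comment> \<open>Acyclicity is inherited through well-foundedness, which pulls back along
    \<open>g\<close>.\<close>
  have "arcs B \<subseteq> inv_image (arcs A) g"
    by (auto simp: B_def g arc)
  then have "wf (arcs B)"
    using is_abpD(3)[OF A] by (meson wf_inv_image wf_subset)
  moreover have "(layer B y = layer B x \<and> (\<exists>c. lab B (x, y) = const_pol c)) \<or>
      (layer B y = Suc (layer B x) \<and> homogeneous_linear (lab B (x, y)))"
    if xy: "(x, y) \<in> arcs B" for x y
  proof -
    obtain u v where uv: "(u, v) \<in> arcs A" "x = e u" "y = e v"
      using xy by (auto simp: B_def)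
    then have "layer B x = layer A u" "layer B y = layer A v" "lab B (x, y) = lab A (u, v)"
      by (simp_all add: B_def g arc)
    moreover have "(layer A v = layer A u \<and> (\<exists>c. lab A (u, v) = const_pol c)) \<or>
        (layer A v = Suc (layer A u) \<and> homogeneous_linear (lab A (u, v)))"
      using A uv(1) unfolding is_abp_def by blast
    ultimately show ?thesis by simp
  qed
  moreover have "arcs B \<subseteq> verts B \<times> verts B"
    by (auto simp: B_def arc)
  moreover have "\<forall>x \<in> verts B. layer B x \<le> depth B" "finite (verts B)" "source B \<in> verts B"
    "layer B (source B) = 0"
    using A by (auto simp: is_abp_def B_def g)
  ultimately have B: "is_abp B"
    unfolding is_abp_def using wf_acyclic by blast
  have val: "value_at B w = value_at A (g w)" if "w \<in> verts B" for w
  proof (rule value_at_unique[OF B _ that])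
    fix w assume "w \<in> verts B"
    then obtain v where v: "v \<in> verts A" "w = e v" by (auto simp: B_def)
    have e_eq: "e v = e v' \<longleftrightarrow> v = v'" if "v' \<in> verts A" for v'
      using e v(1) that by (simp add: inj_on_eq_iff)
    have "w = source B \<longleftrightarrow> v = source A"
      using src by (simp add: B_def v(2) e_eq)
    moreover have "{x. (x, w) \<in> arcs B} = e ` {u. (u, v) \<in> arcs A}"
      by (auto simp: B_def v(2) e_eq arc)
    moreover have "inj_on e {u. (u, v) \<in> arcs A}"
      using e arc by (auto simp: inj_on_def)
    moreover have "(\<Sum>u | (u, v) \<in> arcs A. value_at A (g (e u)) * lab B (e u, w))
        = (\<Sum>u | (u, v) \<in> arcs A. value_at A u * lab A (u, v))"
      using v by (intro sum.cong) (auto simp: B_def g arc)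
    ultimately show "value_at A (g w) = (if w = source B then 1 else 0)
        + (\<Sum>x | (x, w) \<in> arcs B. value_at A (g x) * lab B (x, w))"
      using v by (simp add: g value_at_rec[OF A v(1)] sum.reindex)
  qed
  have layer: "card {w \<in> verts B. layer B w = i} = card {v \<in> verts A. layer A v = i}" for i
  proof -
    have "{w \<in> verts B. layer B w = i} = e ` {v \<in> verts A. layer A v = i}"
      by (auto simp: B_def g)
    then show ?thesis
      using e by (simp add: card_image inj_on_subset)
  qed
  show thesis
  proof (rule that[OF B])
    show "computes B f" if f: "computes A f" for f
    proof -
      obtain v where v: "v \<in> verts A" "value_at A v = f"
        using f by (auto simp: computes_def)
      then have "e v \<in> verts B" by (simp add: B_def)
      then show ?thesis using v val[of "e v"] g by (auto simp: computes_def)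
    qed
    show "abp_width B = abp_width A"
      unfolding abp_width_def layer by (simp add: B_def)
    show "card (verts B) = card (verts A)"
      using e by (simp add: B_def card_image)
  qed
qed

section \<open>The branching program for the polynomials \<open>cpc m k\<close>\<close>

text \<open>
  The layer of a vertex is its last index \<open>k\<close>. \<open>Closed m k\<close> carries \<open>cpc m k\<close> and \<open>Open m c k\<close>
  carries \<open>open_walk m c k\<close>. The latter is only needed for \<open>k \<le> m\<close>, since it contributes to
  \<open>cpc (m + 1) (k + 1)\<close>, which vanishes for \<open>k > m\<close>; this bound saves \<open>d\<^sup>3 / 6\<close> vertices. The
  vertices \<open>Open m c d\<close> have no outgoing arcs: they are there because the required vertex count
  is exact to leading order even for bounded \<open>d\<close>.
\<close>

datatype cpc_vertex = Closed nat nat | Open nat nat nat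

fun cpc_layer :: "cpc_vertex \<Rightarrow> nat" where
  "cpc_layer (Closed m k) = k"
| "cpc_layer (Open m c k) = k"

fun cpc_head :: "cpc_vertex \<Rightarrow> nat" where
  "cpc_head (Closed m k) = m"
| "cpc_head (Open m c k) = m"

text \<open>The index \<open>k\<close> is outermost, so that the number of \<open>Open\<close>
  vertices comes out as a sum over the layers.\<close>

definition cpc_verts :: "nat \<Rightarrow> nat \<Rightarrow> cpc_vertex set" where
  "cpc_verts n d = (\<lambda>(m, k). Closed m k) ` ({..n} \<times> {..d})
     \<union> (\<lambda>(k, m, c). Open m c k) ` (SIGMA k:{1..d}. SIGMA m:{k..<n}. {..<m})"

text \<open>The arcs into a vertex are the terms of its recurrence: \<open>cpc_Suc_0\<close> and
  \<open>cpc_Suc_Suc\<close> for \<open>Closed\<close>, \<open>open_walk_Suc\<close> for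
  \<open>Open\<close>. By \<open>k' \<le> m'\<close> no arc between \<open>Closed\<close> vertices
  enters one whose polynomial vanishes for lack of minors.\<close>

fun cpc_arc :: "cpc_vertex \<Rightarrow> cpc_vertex \<Rightarrow> bool" where
  "cpc_arc (Closed m k) (Closed m' k') \<longleftrightarrow> m' = Suc m \<and> k' \<le> m' \<and> (k' = k \<or> k' = Suc k)"
| "cpc_arc (Closed m k) (Open m' c k') \<longleftrightarrow> m' = m \<and> k' = Suc k"
| "cpc_arc (Open m c k) (Open m' c' k') \<longleftrightarrow> m' = m \<and> k' = Suc k"
| "cpc_arc (Open m c k) (Closed m' k') \<longleftrightarrow> m' = Suc m \<and> k' = Suc k"

fun cpc_lab :: "cpc_vertex \<times> cpc_vertex \<Rightarrow> 'a::comm_ring_1 mpol" where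
  "cpc_lab (Closed m k, Closed m' k') = (if k' = k then 1 else var_pol (m, m))"
| "cpc_lab (Closed m k, Open m' c k') = var_pol (m, c)"
| "cpc_lab (Open m c k, Open m' c' k') = - var_pol (c, c')"
| "cpc_lab (Open m c k, Closed m' k') = - var_pol (c, m)"

definition cpc_abp :: "nat \<Rightarrow> nat \<Rightarrow> (cpc_vertex, 'a::comm_ring_1) abp" where
  "cpc_abp n d =
     \<lparr>verts = cpc_verts n d,
      arcs = {(u, v). u \<in> cpc_verts n d \<and> v \<in> cpc_verts n d \<and> cpc_arc u v},
      lab = cpc_lab, layer = cpc_layer, depth = d, source = Closed 0 0\<rparr>"

fun cpc_val :: "cpc_vertex \<Rightarrow> 'a::comm_ring_1 mpol" where
  "cpc_val (Closed m k) = cpc m k"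
| "cpc_val (Open m c k) = open_walk m c k"

lemma Closed_in_cpc_verts [simp]: "Closed m k \<in> cpc_verts n d \<longleftrightarrow> m \<le> n \<and> k \<le> d"
  by (auto simp: cpc_verts_def)

lemma Open_in_cpc_verts [simp]:
  "Open m c k \<in> cpc_verts n d \<longleftrightarrow> 1 \<le> k \<and> k \<le> d \<and> k \<le> m \<and> m < n \<and> c < m"
  by (auto simp: cpc_verts_def image_iff)

lemma homogeneous_linear_var_pol: "homogeneous_linear (var_pol v)"
  by (cases v) (auto simp: homogeneous_linear_def var_pol_def)

lemma homogeneous_linear_uminus: "homogeneous_linear (- p) \<longleftrightarrow> homogeneous_linear p"
  by (simp add: homogeneous_linear_def keys_def)

lemma is_abp_cpc_abp: "is_abp (cpc_abp n d :: (cpc_vertex, 'a::comm_ring_1) abp)"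
proof -
  let ?A = "cpc_abp n d :: (cpc_vertex, 'a) abp"
  \<comment> \<open>Arcs within a layer raise the head \<open>m\<close>, all others raise the
    layer.\<close>
  let ?lex = "inv_image (less_than <*lex*> less_than) (\<lambda>v. (cpc_layer v, cpc_head v))"
  have "(u, v) \<in> ?lex" if "cpc_arc u v" for u v
    using that by (cases u; cases v) auto
  then have "arcs ?A \<subseteq> ?lex"
    by (auto simp: cpc_abp_def)
  then have "acyclic (arcs ?A)"
    by (metis acyclic_subset wf_acyclic wf_inv_image wf_less_than wf_lex_prod)
  moreover have "finite (verts ?A)"
    by (simp add: cpc_abp_def cpc_verts_def)
  moreover have "\<forall>v \<in> verts ?A. layer ?A v \<le> depth ?A"
    by (auto simp: cpc_abp_def cpc_verts_def)
  moreover have "cpc_layer v = cpc_layer u \<and> (\<exists>c. cpc_lab (u, v) = (const_pol c :: 'a mpol)) \<or>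
      cpc_layer v = Suc (cpc_layer u) \<and> homogeneous_linear (cpc_lab (u, v) :: 'a mpol)"
    if "cpc_arc u v" for u v
  proof -
    have "\<exists>c. (1 :: 'a mpol) = const_pol c"
      by (rule exI[of _ 1]) (simp add: const_pol_def)
    then show ?thesis
      using that by (cases u; cases v)
        (auto simp: homogeneous_linear_var_pol homogeneous_linear_uminus)
  qed
  ultimately show ?thesis
    by (auto simp: is_abp_def cpc_abp_def)
qed

text \<open>There are no \<open>Open\<close> vertices in layer 0, but
  \<open>open_walk m c 0 = 0\<close>, so the recurrences can be applied uniformly in
  \<open>k\<close>.\<close>

lemma sum_Open_open_walk:
  assumes "k \<le> m" "m < n" "k \<le> d"
  shows "(\<Sum>u | u \<in> cpc_verts n d \<and> (\<exists>c. u = Open m c k). cpc_val u * f u)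
    = (\<Sum>c<m. open_walk m c k * f (Open m c k))"
proof (cases "k = 0")
  case True
  then have "{u. u \<in> cpc_verts n d \<and> (\<exists>c. u = Open m c k)} = {}" by auto
  then show ?thesis using True by (simp only: sum.empty) (simp add: open_walk_0)
next
  case False
  then have "{u. u \<in> cpc_verts n d \<and> (\<exists>c. u = Open m c k)} = (\<lambda>c. Open m c k) ` {..<m}"
    using assms by auto
  then show ?thesis by (simp add: sum.reindex inj_on_def)
qed

text \<open>The cases \<open>degree0\<close>, \<open>closed\<close> and \<open>walk\<close> are the
  three recurrences. In the cases \<open>zero\<close> and \<open>large\<close> no arc enters
  \<open>v\<close>, and the only nonzero value, \<open>cpc 0 0 = 1\<close>, is supplied by the
  source.\<close>

lemma cpc_val_rec:
  assumes v: "v \<in> cpc_verts n d"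
  shows "(cpc_val v :: 'a::comm_ring_1 mpol) = (if v = Closed 0 0 then 1 else 0)
    + (\<Sum>u | u \<in> cpc_verts n d \<and> cpc_arc u v. cpc_val u * cpc_lab (u, v))"
proof -
  let ?I = "\<lambda>v. {u. u \<in> cpc_verts n d \<and> cpc_arc u v}"
  let ?O = "\<lambda>m k. {u. u \<in> cpc_verts n d \<and> (\<exists>c. u = Open m c k)}"
  have fin: "finite (?O m k)" for m k
    by (rule finite_subset[of _ "cpc_verts n d"]) (auto simp: cpc_verts_def)
  consider (zero) k where "v = Closed 0 k"
    | (degree0) m where "v = Closed (Suc m) 0"
    | (large) m k where "v = Closed (Suc m) (Suc k)" "m < k"
    | (closed) m k where "v = Closed (Suc m) (Suc k)" "k \<le> m"
    | (walk) m c k where "v = Open m c (Suc k)"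
  proof (cases v)
    case (Closed m k)
    with that show ?thesis by (cases m; cases k) (auto simp: not_le[symmetric])
  next
    case (Open m c k)
    with that v show ?thesis by (cases k) auto
  qed
  then show ?thesis
  proof cases
    case zero
    have "\<not> cpc_arc u (Closed 0 k)" for u by (cases u) auto
    then show ?thesis by (simp add: zero cpc_0_left)
  next
    case degree0
    have "?I v = {Closed m 0}"
    proof (intro equalityI subsetI)
      fix u assume "u \<in> ?I v"
      then show "u \<in> {Closed m 0}" by (cases u) (auto simp: degree0)
    qed (use v in \<open>auto simp: degree0\<close>)
    then show ?thesis by (simp add: degree0 cpc_Suc_0)
  next
    case large
    have "?I v = {}"
    proof -
      have "\<not> (u \<in> cpc_verts n d \<and> cpc_arc u v)" for u
        using large by (cases u) auto
      then show ?thesis by blast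
    qed
    then show ?thesis using large by (simp only: sum.empty) (simp add: cpc_eq_0)
  next
    case closed
    have I: "?I v = {Closed m (Suc k), Closed m k} \<union> ?O m k"
    proof (intro equalityI subsetI)
      fix u assume "u \<in> ?I v"
      then show "u \<in> {Closed m (Suc k), Closed m k} \<union> ?O m k" by (cases u) (auto simp: closed)
    qed (use v in \<open>auto simp: closed\<close>)
    have "(\<Sum>u\<in>?I v. cpc_val u * cpc_lab (u, v) :: 'a mpol)
        = cpc m (Suc k) + cpc m k * var_pol (m, m)
          + (\<Sum>u\<in>?O m k. cpc_val u * cpc_lab (u, v))"
      unfolding I by (subst sum.union_disjoint) (auto simp: fin closed)
    also have "(\<Sum>u\<in>?O m k. cpc_val u * cpc_lab (u, v) :: 'a mpol)
        = - (\<Sum>c<m. open_walk m c k * var_pol (c, m))"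
      using v closed(2) by (subst sum_Open_open_walk) (auto simp: closed(1) sum_negf)
    finally show ?thesis by (simp add: closed cpc_Suc_Suc)
  next
    case walk
    have I: "?I v = {Closed m k} \<union> ?O m k"
    proof (intro equalityI subsetI)
      fix u assume "u \<in> ?I v"
      then show "u \<in> {Closed m k} \<union> ?O m k" by (cases u) (auto simp: walk)
    qed (use v in \<open>auto simp: walk\<close>)
    have "(\<Sum>u\<in>?I v. cpc_val u * cpc_lab (u, v) :: 'a mpol)
        = cpc m k * var_pol (m, c) + (\<Sum>u\<in>?O m k. cpc_val u * cpc_lab (u, v))"
      unfolding I by (subst sum.union_disjoint) (auto simp: fin walk)
    also have "(\<Sum>u\<in>?O m k. cpc_val u * cpc_lab (u, v) :: 'a mpol)
        = - (\<Sum>c'<m. open_walk m c' k * var_pol (c', c))"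
      using v by (subst sum_Open_open_walk) (auto simp: walk sum_negf)
    \<comment> \<open>Membership of \<open>Open m c (Suc k)\<close> gives \<open>k < m\<close>, as
      \<open>open_walk_Suc\<close> requires.\<close>
    finally show ?thesis using v by (simp add: walk open_walk_Suc mult.commute)
  qed
qed

lemma cpc_abp_computes:
  assumes "n' \<le> n" "d' \<le> d"
  shows "computes (cpc_abp n d) (cpc n' d' :: 'a::comm_ring_1 mpol)"
proof -
  let ?A = "cpc_abp n d :: (cpc_vertex, 'a) abp"
  have "value_at ?A v = cpc_val v" if "v \<in> verts ?A" for v
  proof (rule value_at_unique[OF is_abp_cpc_abp _ that])
    fix v assume v: "v \<in> verts ?A"
    then have "{u. (u, v) \<in> arcs ?A} = {u. u \<in> cpc_verts n d \<and> cpc_arc u v}"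
      by (auto simp: cpc_abp_def)
    then show "cpc_val v = (if v = source ?A then 1 else 0)
        + (\<Sum>u | (u, v) \<in> arcs ?A. cpc_val u * lab ?A (u, v))"
      using cpc_val_rec[of v n d, where 'a = 'a] v by (simp add: cpc_abp_def)
  qed
  moreover have "Closed n' d' \<in> verts ?A"
    using assms by (simp add: cpc_abp_def)
  ultimately show ?thesis
    by (metis computes_def cpc_val.simps(1))
qed

section \<open>Width and number of vertices\<close>

lemma sum_atLeastLessThan_real:
  assumes "k \<le> n"
  shows "real (\<Sum>m = k..<n. m) = real n * (real n - 1) / 2 - real k * (real k - 1) / 2"
  using assms by (induction n rule: dec_induct) (simp_all add: field_simps)

text \<open>An inner layer \<open>k\<close> has \<open>n + 1\<close> vertices
  \<open>Closed m k\<close> and at most \<open>n * (n - 1) / 2\<close> vertices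
  \<open>Open m c k\<close>.\<close>

lemma abp_width_cpc_abp:
  assumes "d \<le> n"
  shows "real (abp_width (cpc_abp n d :: (cpc_vertex, 'a::comm_ring_1) abp))
    \<le> real n ^ 2 / 2 + (real n / 2 + 1)"
proof -
  let ?A = "cpc_abp n d :: (cpc_vertex, 'a) abp"
  have layer: "real (card {v \<in> verts ?A. layer ?A v = k}) \<le> real n ^ 2 / 2 + (real n / 2 + 1)"
    if k: "k \<in> {0<..<d}" for k
  proof -
    have "{v \<in> verts ?A. layer ?A v = k}
        = (\<lambda>m. Closed m k) ` {..n} \<union> (\<lambda>(m, c). Open m c k) ` (SIGMA m:{k..<n}. {..<m})"
      using k by (auto simp: cpc_abp_def cpc_verts_def image_iff)
    then have "card {v \<in> verts ?A. layer ?A v = k}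
        \<le> card ((\<lambda>m. Closed m k) ` {..n})
          + card ((\<lambda>(m, c). Open m c k) ` (SIGMA m:{k..<n}. {..<m}))"
      by (simp add: card_Un_le)
    also have "\<dots> \<le> card {..n} + card (SIGMA m:{k..<n}. {..<m})"
      by (intro add_mono card_image_le) auto
    also have "\<dots> = Suc n + (\<Sum>m = k..<n. m)"
      by simp
    finally have "real (card {v \<in> verts ?A. layer ?A v = k}) \<le> real (Suc n) + real (\<Sum>m = k..<n. m)"
      by linarith
    also have "real (\<Sum>m = k..<n. m) \<le> real n * (real n - 1) / 2"
      using k assms by (subst sum_atLeastLessThan_real) auto
    finally show ?thesis by (simp add: field_simps power2_eq_square)
  qed
  have "abp_width ?A \<in> insert 0 ((\<lambda>i. card {v \<in> verts ?A. layer ?A v = i}) ` {0<..<depth ?A})"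
    unfolding abp_width_def by (rule Max_in) auto
  then show ?thesis
    using layer by (auto simp: cpc_abp_def)
qed

lemma card_verts_cpc_abp:
  assumes "d \<le> n"
  shows "real (card (verts (cpc_abp n d :: (cpc_vertex, 'a::comm_ring_1) abp)))
    = real d * real n ^ 2 / 2 - real d ^ 3 / 6
      + ((real d + 1) * (real n + 1) - real d * real n / 2 + real d / 6)"
proof -
  have "card (cpc_verts n d) = card ({..n} \<times> {..d})
      + card (SIGMA k:{1..d}. SIGMA m:{k..<n}. {..<m})"
    unfolding cpc_verts_def
    by (subst card_Un_disjoint) (auto simp: card_image inj_on_def)
  also have "\<dots> = Suc n * Suc d + (\<Sum>k = 1..d. \<Sum>m = k..<n. m)"
    by simp
  finally have card: "real (card (cpc_verts n d))
      = (real n + 1) * (real d + 1) + (\<Sum>k = 1..d. real (\<Sum>m = k..<n. m))"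
    by (simp add: algebra_simps)
  also have "(\<Sum>k = 1..d. real (\<Sum>m = k..<n. m))
      = (\<Sum>k = 1..d. real n * (real n - 1) / 2 - real k * (real k - 1) / 2)"
    using assms by (intro sum.cong refl sum_atLeastLessThan_real) auto
  \<comment> \<open>The subtracted terms \<open>k * (k - 1) / 2\<close> are binomial coefficients,
    which sum to \<open>d + 1\<close> choose 3; this is the saving of \<open>d ^ 3 / 6\<close> to
    leading order.\<close>
  also have "\<dots> = real d * (real n * (real n - 1) / 2)
      - (real d + 1) * real d * (real d - 1) / 6"
    by (induction d) (simp_all add: field_simps)
  finally show ?thesis
    by (simp add: cpc_abp_def field_simps power2_eq_square power3_eq_cube)
qed

text \<open>For \<open>n \<ge> 1\<close> the error is at most \<open>3 * (d + 1) * n\<close>. The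
  factor \<open>d + 1\<close> makes the comparison meaningful for \<open>d = 0\<close> too, where
  the error is \<open>n + 1\<close>.\<close>

lemma vertex_error_smallo:
  "(\<lambda>(n, d). (real d + 1) * (real n + 1) - real d * real n / 2 + real d / 6)
    \<in> o[at_top_le](\<lambda>(n, d). (real d + 1) * real n ^ 2)"
proof (rule landau_o.smallI)
  fix c :: real assume c: "c > 0"
  \<comment> \<open>From \<open>n \<ge> 3 / c\<close> follows \<open>3 * n \<le> c * n ^ 2\<close>;
    the added 1 ensures \<open>n \<ge> 1\<close>.\<close>
  have "eventually (\<lambda>p. fst p \<ge> nat \<lceil>3 / c\<rceil> + 1) at_top_le"
    unfolding at_top_le_def
    by (rule filter_leD[OF inf_le1]) (auto intro: eventually_filtercomapI eventually_ge_at_top)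
  then show "eventually (\<lambda>p. norm (case p of (n, d) \<Rightarrow>
        (real d + 1) * (real n + 1) - real d * real n / 2 + real d / 6)
      \<le> c * norm (case p of (n, d) \<Rightarrow> (real d + 1) * real n ^ 2)) at_top_le"
  proof (rule eventually_mono)
    fix p :: "nat \<times> nat" assume p: "fst p \<ge> nat \<lceil>3 / c\<rceil> + 1"
    obtain n d where nd: "p = (n, d)" by (cases p)
    have n: "real n \<ge> 1" "3 / c \<le> real n"
      using p nd real_nat_ceiling_ge[of "3 / c"] by auto
    let ?e = "(real d + 1) * (real n + 1) - real d * real n / 2 + real d / 6"
    have dn: "real d * real n \<ge> 0" "real d \<le> real d * real n"
      using n mult_left_mono[OF n(1), of "real d"] by auto
    have "0 \<le> ?e" using dn by (simp add: algebra_simps)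
    moreover have "?e \<le> (real d + 1) * (3 * real n)"
      using dn n by (simp add: algebra_simps)
    moreover have "3 * real n \<le> c * real n * real n"
      using n c by (intro mult_right_mono) (simp_all add: field_simps)
    then have "(real d + 1) * (3 * real n) \<le> (real d + 1) * (c * real n * real n)"
      by (intro mult_left_mono) auto
    ultimately show "norm (case p of (n, d) \<Rightarrow>
        (real d + 1) * (real n + 1) - real d * real n / 2 + real d / 6)
      \<le> c * norm (case p of (n, d) \<Rightarrow> (real d + 1) * real n ^ 2)"
      by (simp add: nd power2_eq_square abs_mult algebra_simps)
  qed
qed

section \<open>Minimal width and the combined bounds\<close>

lemma min_width_le:
  fixes A :: "(nat, 'a::comm_ring_1) abp"
  assumes "is_abp A" and "\<And>f. f \<in> S \<Longrightarrow> computes A f"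
  shows "min_width S \<le> abp_width A"
  unfolding min_width_def by (rule Least_le) (use assms in blast)

theorem theorem6p1:
  "\<exists>(ew :: nat \<Rightarrow> real) (ev :: nat \<times> nat \<Rightarrow> real) (ed :: nat \<Rightarrow> real).
     ew \<in> o(\<lambda>n. real n ^ 2) \<and>
     ev \<in> o[at_top_le](\<lambda>(n, d). (real d + 1) * real n ^ 2) \<and>
     ed \<in> o(\<lambda>n. real n ^ 3) \<and>
     (\<forall>n d. d \<le> n \<longrightarrow>
        (\<exists>A :: (nat, 'a::comm_ring_1) abp.
           is_abp A \<and>
           (\<forall>n'\<le>n. \<forall>d'\<le>d. computes A (cpc n' d')) \<and>
           real (abp_width A) \<le> real n ^ 2 / 2 + ew n \<and>
           real (card (verts A)) = real d * real n ^ 2 / 2 - real d ^ 3 / 6 + ev (n, d) \<and>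
           (d = n \<longrightarrow> real (card (verts A)) = real n ^ 3 / 3 + ed n)) \<and>
        real (min_width {cpc n' d' :: 'a mpol | n' d'. n' \<le> n \<and> d' \<le> d})
          \<le> real n ^ 2 / 2 + ew n)"
proof -
  define ev :: "nat \<times> nat \<Rightarrow> real" where
    "ev = (\<lambda>(n, d). (real d + 1) * (real n + 1) - real d * real n / 2 + real d / 6)"
  define ew :: "nat \<Rightarrow> real" where "ew = (\<lambda>n. real n / 2 + 1)"
  \<comment> \<open>On the diagonal the main term is
    \<open>n ^ 3 / 2 - n ^ 3 / 6 = n ^ 3 / 3\<close>, so the remainder is that of the general
    count.\<close>
  define ed :: "nat \<Rightarrow> real" where "ed = (\<lambda>n. ev (n, n))"
  have "ew \<in> o(\<lambda>n. real n ^ 2)"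
    unfolding ew_def by real_asymp
  moreover have "ev \<in> o[at_top_le](\<lambda>(n, d). (real d + 1) * real n ^ 2)"
    unfolding ev_def by (rule vertex_error_smallo)
  moreover have "ed \<in> o(\<lambda>n. real n ^ 3)"
    unfolding ed_def ev_def prod.case by real_asymp
  moreover have "(\<exists>A :: (nat, 'a) abp. is_abp A \<and>
        (\<forall>n'\<le>n. \<forall>d'\<le>d. computes A (cpc n' d')) \<and>
        real (abp_width A) \<le> real n ^ 2 / 2 + ew n \<and>
        real (card (verts A)) = real d * real n ^ 2 / 2 - real d ^ 3 / 6 + ev (n, d) \<and>
        (d = n \<longrightarrow> real (card (verts A)) = real n ^ 3 / 3 + ed n)) \<and>
      real (min_width {cpc n' d' :: 'a mpol | n' d'. n' \<le> n \<and> d' \<le> d})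
        \<le> real n ^ 2 / 2 + ew n" if d: "d \<le> n" for n d
  proof -
    obtain A :: "(nat, 'a) abp" where A: "is_abp A"
      and comp: "\<And>f. computes (cpc_abp n d) f \<Longrightarrow> computes A f"
      and width: "abp_width A = abp_width (cpc_abp n d :: (cpc_vertex, 'a) abp)"
      and card: "card (verts A) = card (verts (cpc_abp n d :: (cpc_vertex, 'a) abp))"
      using abp_relabel_nat[OF is_abp_cpc_abp] by blast
    have all: "computes A (cpc n' d')" if "n' \<le> n" "d' \<le> d" for n' d'
      using that by (intro comp cpc_abp_computes)
    have w: "real (abp_width A) \<le> real n ^ 2 / 2 + ew n"
      unfolding width ew_def by (rule abp_width_cpc_abp[OF d])
    have v: "real (card (verts A)) = real d * real n ^ 2 / 2 - real d ^ 3 / 6 + ev (n, d)"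
      unfolding card ev_def prod.case by (rule card_verts_cpc_abp[OF d])
    have "real (card (verts A)) = real n ^ 3 / 3 + ed n" if "d = n"
      using v that by (simp add: ed_def power2_eq_square power3_eq_cube)
    moreover have "min_width {cpc n' d' :: 'a mpol | n' d'. n' \<le> n \<and> d' \<le> d} \<le> abp_width A"
      by (rule min_width_le[OF A]) (auto intro: all)
    ultimately show ?thesis
      using A all w v by (intro conjI exI[of _ A]) auto
  qed
  ultimately show ?thesis by blast
qed

end
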